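(* Let $\mathbf{P}\subset\mathbb{C}$ be a Jordan arc and let $A\colon\mathbf{P}\to\mathbb{C}^{n\times n}$, $B\colon\mathbf{P}\to\mathbb{C}^{n\times m}$ be continuous. Suppose that the Kronecker indices of $(A(\theta),B(\theta))$ are independent of $\theta$, say $\kappa(A(\theta),B(\theta))=(\kappa_1,\dots,\kappa_m)$ for all $\theta\in\mathbf{P}$, and that $\sum_{i=1}^m\kappa_i=n$. Then $(A,B)$ is restricted feedback equivalent on $\mathbf{P}$ to $(A_\kappa,B_\kappa)$, i.e. there exists a restricted feedback transformation $(T,F,S)$ on $\mathbf{P}$ with $(T,F,S)\cdot(A,B)=(A_\kappa,B_\kappa)$, equivalently $T(\theta)A(\theta)-A_\kappa T(\theta)=B_\kappa F(\theta)$ and $T(\theta)B(\theta)=B_\kappa S(\theta)$ for all $\theta\in\mathbf{P}$.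
   Context: A Jordan arc is the image of a continuous injective map from a compact interval into $\mathbb{C}$. For a pair $(A,B)\in\mathbb{C}^{n\times n}\times\mathbb{C}^{n\times m}$ with columns $b_1,\dots,b_m$ of $B$, the Kronecker indices $\kappa(A,B)=(\kappa_1,\dots,\kappa_m)$ are defined as follows: go through the list $b_1,\dots,b_m,Ab_1,\dots,Ab_m,A^2b_1,\dots,A^2b_m,\dots,A^{n-1}b_1,\dots,A^{n-1}b_m$ from left to right and select each vector that is linearly independent of the previously selected ones; the selected vectors are then of the form $b_i,Ab_i,\dots,A^{\kappa_i-1}b_i$ ($i=1,\dots,m$), which defines $\kappa_i$ ($\kappa_i=0$ if $b_i$ is not selected). The pair is reachable iff $\sum_i\kappa_i=n$. For $\kappa=(\kappa_1,\dots,\kappa_m)$ with $\sum\kappa_i=n$, $(A_\kappa,B_\kappa)$ is the pair with $A_\kappa=\mathrm{diag}(A_{\kappa_1},\dots,A_{\kappa_m})\in\mathbb{C}^{n\times n}$ (block diagonal) and $B_\kappa\in\mathbb{C}^{n\times m}$ block diagonal with blocks $b_{\kappa_1},\dots,b_{\kappa_m}$, where for $\kappa_i\ge1$, $A_{\kappa_i}\in\mathbb{C}^{\kappa_i\times\kappa_i}$ is the lower shift matrix (ones on the first subdiagonal, zeros elsewhere) and $b_{\kappa_i}=(1,0,\dots,0)^\top\in\mathbb{C}^{\kappa_i}$; if $\kappa_i=0$ the block $A_{\kappa_i}$ is absent and the $i$-th column of $B_\kappa$ is zero. Equivalently, the $i$-th column of $B_\kappa$ is $e_{1+\kappa_1+\dots+\kappa_{i-1}}$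 when $\kappa_i\ge1$. A restricted feedback transformation on $\mathbf{P}$ is a triple $(T,F,S)$ of continuous maps $T\colon\mathbf{P}\to\mathbb{C}^{n\times n}$, $F\colon\mathbf{P}\to\mathbb{C}^{m\times n}$, $S\colon\mathbf{P}\to\mathbb{C}^{m\times m}$ such that for every $\theta$, $T(\theta)$ is invertible and $S(\theta)$ is upper triangular with all diagonal entries equal to $1$. It acts on pairs of continuous maps by $(T,F,S)\cdot(A,B)=\big(T(A-BS^{-1}F)T^{-1},\,TBS^{-1}\big)$, pointwise in $\theta$. Two pairs are restricted feedback equivalent on $\mathbf{P}$ if one is obtained from the other by such an action. *)

theory Defs
  imports "HOL-Analysis.Analysis" "Jordan_Normal_Form.Matrix"
begin

definition in_span :: "nat \<Rightarrow> complex vec list \<Rightarrow> complex vec \<Rightarrow> bool" where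
  "in_span n S v \<longleftrightarrow> (\<exists>c. dim_vec c = length S \<and> v = mat_of_cols n S *\<^sub>v c)"

fun kron_select :: "nat \<Rightarrow> complex vec list \<Rightarrow> complex vec list \<Rightarrow> bool list" where
  "kron_select n S [] = []"
| "kron_select n S (v # vs) =
     (if in_span n S v then False # kron_select n S vs
      else True # kron_select n (S @ [v]) vs)"

text \<open>The Krylov list b_1,...,b_m, A b_1,...,A b_m, ..., A^(n-1) b_1, ..., A^(n-1) b_m
  (indices start at 0: position j*m+i holds A^j b_i).\<close>
definition krylov_list :: "complex mat \<Rightarrow> complex mat \<Rightarrow> complex vec list" where
  "krylov_list A B = concat (map (\<lambda>j. map (\<lambda>i. (A ^\<^sub>m j) *\<^sub>v col B i) [0..<dim_col B])
                                 [0..<dim_row A])"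

definition kronecker_indices :: "complex mat \<Rightarrow> complex mat \<Rightarrow> nat list" where
  "kronecker_indices A B =
     (let n = dim_row A; m = dim_col B; sel = kron_select n [] (krylov_list A B)
      in map (\<lambda>i. card {j. j < n \<and> sel ! (j * m + i)}) [0..<m])"

definition shift_mat :: "nat \<Rightarrow> complex mat" where
  "shift_mat k = mat k k (\<lambda>(r, c). if r = c + 1 then 1 else 0)"

definition first_unit_col :: "nat \<Rightarrow> complex mat" where
  "first_unit_col k = mat k 1 (\<lambda>(r, c). if r = 0 then 1 else 0)"

text \<open>Block diagonal Brunovsky pair (A_kappa, B_kappa); blocks with kappa_i = 0 are absent
  in A_kappa and give a zero column in B_kappa.\<close>
fun A_kappa :: "nat list \<Rightarrow> complex mat" where
  "A_kappa [] = 0\<^sub>m 0 0"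
| "A_kappa (k # ks) = four_block_mat (shift_mat k) (0\<^sub>m k (sum_list ks))
                                     (0\<^sub>m (sum_list ks) k) (A_kappa ks)"

fun B_kappa :: "nat list \<Rightarrow> complex mat" where
  "B_kappa [] = 0\<^sub>m 0 0"
| "B_kappa (k # ks) = four_block_mat (first_unit_col k) (0\<^sub>m k (length ks))
                                     (0\<^sub>m (sum_list ks) 1) (B_kappa ks)"

definition continuous_mat_on :: "complex set \<Rightarrow> nat \<Rightarrow> nat \<Rightarrow> (complex \<Rightarrow> complex mat) \<Rightarrow> bool" where
  "continuous_mat_on P r c M \<longleftrightarrow>
     (\<forall>\<theta>\<in>P. M \<theta> \<in> carrier_mat r c) \<and>
     (\<forall>i<r. \<forall>j<c. continuous_on P (\<lambda>\<theta>. M \<theta> $$ (i, j)))"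

definition jordan_arc :: "complex set \<Rightarrow> bool" where
  "jordan_arc P \<longleftrightarrow> (\<exists>g. arc g \<and> P = path_image g)"

end

theory Submission
  imports Defs "Jordan_Normal_Form.Determinant"
begin

text \<open>
  A vector of the Krylov list is selected iff it is not a combination of the earlier ones, and
  this property is inherited downwards along \<open>b\<^sub>i, A b\<^sub>i, \<dots>\<close>. The Kronecker indices therefore
  determine which positions are selected, and since they sum to \<open>n\<close> the selected vectors form an
  invertible matrix \<open>K\<close> depending continuously on the parameter. Let \<open>t\<^sub>i\<close> be the row of \<open>K\<^sup>-\<^sup>1\<close>
  dual to \<open>A\<^bsup>\<kappa>\<^sub>i-1\<^esup>b\<^sub>i\<close>. It vanishes on every vector that precedes \<open>A\<^bsup>\<kappa>\<^sub>i-1\<^esup>b\<^sub>i\<close> in the Krylov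
  list, because those are combinations of selected vectors at earlier positions. Hence the matrix
  \<open>T\<close> with the rows \<open>t\<^sub>i A\<^bsup>\<kappa>\<^sub>i-1\<^esup>, \<dots>, t\<^sub>i\<close> satisfies \<open>T B = B\<^sub>\<kappa> S\<close> with \<open>S\<close> unitriangular,
  \<open>T A - A\<^sub>\<kappa> T\<close> is supported on the first rows of the blocks, and \<open>T K\<close> is triangular with unit
  diagonal once its rows and columns are ordered by position in the Krylov list.
\<close>

section \<open>Greedy selection of linearly independent vectors\<close>

text \<open>Vectors are represented as functions on \<open>nat\<close>, of which only the coordinates below \<open>n\<close> matter.\<close>

definition spanned :: "nat \<Rightarrow> (nat \<Rightarrow> nat \<Rightarrow> complex) \<Rightarrow> nat set \<Rightarrow> (nat \<Rightarrow> complex) \<Rightarrow> bool" where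
  "spanned n w Q v \<longleftrightarrow> (\<exists>c. \<forall>x<n. v x = (\<Sum>q\<in>Q. c q * w q x))"

lemma spanned_mono:
  assumes "spanned n w Q v" "Q \<subseteq> Q'" "finite Q'"
  shows "spanned n w Q' v"
proof -
  obtain c where c: "\<forall>x<n. v x = (\<Sum>q\<in>Q. c q * w q x)"
    using assms(1) unfolding spanned_def by blast
  have "(\<Sum>q\<in>Q. c q * w q x) = (\<Sum>q\<in>Q'. (if q \<in> Q then c q else 0) * w q x)" for x
    by (rule sum.mono_neutral_cong_left) (use assms in auto)
  with c show ?thesis unfolding spanned_def by (intro exI[of _ "\<lambda>q. if q \<in> Q then c q else 0"]) simp
qed

text \<open>A rejected vector adds nothing to the span. This allows passage between the span of the
  selected predecessors and the span of all predecessors.\<close>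

lemma spanned_insert_redundant:
  assumes "finite Q" "spanned n w Q (w p)"
  shows "spanned n w (insert p Q) v \<longleftrightarrow> spanned n w Q v"
proof (cases "p \<in> Q")
  case False
  obtain d where d: "\<forall>x<n. w p x = (\<Sum>q\<in>Q. d q * w q x)"
    using assms(2) unfolding spanned_def by blast
  show ?thesis
  proof
    assume "spanned n w (insert p Q) v"
    then obtain c where c: "\<forall>x<n. v x = (\<Sum>q\<in>insert p Q. c q * w q x)"
      unfolding spanned_def by blast
    have "v x = (\<Sum>q\<in>Q. (c q + c p * d q) * w q x)" if "x < n" for x
    proof -
      have "v x = c p * w p x + (\<Sum>q\<in>Q. c q * w q x)" using c that False assms(1) by simp
      also have "w p x = (\<Sum>q\<in>Q. d q * w q x)" using d that by blast
      finally show ?thesis by (simp add: sum_distrib_left sum.distrib algebra_simps)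
    qed
    then show "spanned n w Q v" unfolding spanned_def by (intro exI[of _ "\<lambda>q. c q + c p * d q"]) simp
  qed (rule spanned_mono, use assms in auto)
qed (simp add: insert_absorb)

lemma functional_zero_if_spanned:
  assumes "spanned n w Q v" "\<And>q. q \<in> Q \<Longrightarrow> (\<Sum>y<n. t y * w q y) = 0"
  shows "(\<Sum>y<n. t y * v y) = 0"
proof -
  obtain c where c: "\<forall>x<n. v x = (\<Sum>q\<in>Q. c q * w q x)"
    using assms(1) unfolding spanned_def by blast
  have "(\<Sum>y<n. t y * v y) = (\<Sum>y<n. \<Sum>q\<in>Q. c q * (t y * w q y))"
    using c by (intro sum.cong) (auto simp: sum_distrib_left algebra_simps)
  also have "\<dots> = (\<Sum>q\<in>Q. c q * (\<Sum>y<n. t y * w q y))"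
    by (subst sum.swap) (simp add: sum_distrib_left)
  finally show ?thesis using assms(2) by simp
qed

text \<open>Distinct labels let coefficients indexed by list position be traded for coefficients
  indexed by label; the vectors \<open>u q\<close> themselves may coincide.\<close>

lemma in_span_iff_spanned:
  assumes "distinct qs" "\<And>q. q \<in> set qs \<Longrightarrow> u q \<in> carrier_vec n" "v \<in> carrier_vec n"
  shows "in_span n (map u qs) v \<longleftrightarrow> spanned n (\<lambda>q x. vec_index (u q) x) (set qs) (vec_index v)"
proof -
  have entry: "vec_index (mat_of_cols n (map u qs) *\<^sub>v c) x
      = (\<Sum>k<length qs. vec_index c k * vec_index (u (qs ! k)) x)"
    if "dim_vec c = length qs" "x < n" for c x
    using that by (auto simp: mat_of_cols_def scalar_prod_def lessThan_atLeast0 mult.commute intro!: sum.cong)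
  have reidx: "(\<Sum>k<length qs. f (qs ! k)) = (\<Sum>q\<in>set qs. f q)" for f :: "nat \<Rightarrow> complex"
    by (rule sum.reindex_bij_betw[OF bij_betw_nth]) (use assms in auto)
  show ?thesis
  proof
    assume "in_span n (map u qs) v"
    then obtain c where c: "dim_vec c = length qs" "v = mat_of_cols n (map u qs) *\<^sub>v c"
      unfolding in_span_def by auto
    define d where "d q = vec_index c (inv_into {..<length qs} ((!) qs) q)" for q
    have inj: "inj_on ((!) qs) {..<length qs}" using assms(1) by (auto simp: inj_on_def nth_eq_iff_index_eq)
    have d: "d (qs ! k) = vec_index c k" if "k < length qs" for k
      unfolding d_def using inv_into_f_f[OF inj] that by simp
    have "vec_index v x = (\<Sum>q\<in>set qs. d q * vec_index (u q) x)" if "x < n" for x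
      using entry[OF c(1) that] d by (simp add: c(2) flip: reidx)
    then show "spanned n (\<lambda>q x. vec_index (u q) x) (set qs) (vec_index v)" unfolding spanned_def by blast
  next
    assume "spanned n (\<lambda>q x. vec_index (u q) x) (set qs) (vec_index v)"
    then obtain d where d: "\<forall>x<n. vec_index v x = (\<Sum>q\<in>set qs. d q * vec_index (u q) x)"
      unfolding spanned_def by blast
    define c where "c = vec (length qs) (\<lambda>k. d (qs ! k))"
    have "v = mat_of_cols n (map u qs) *\<^sub>v c"
    proof (rule eq_vecI)
      fix x assume "x < dim_vec (mat_of_cols n (map u qs) *\<^sub>v c)"
      then have x: "x < n" by simp
      have "dim_vec c = length qs" by (simp add: c_def)
      from entry[OF this x] show "vec_index v x = vec_index (mat_of_cols n (map u qs) *\<^sub>v c) x"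
        using d x by (simp add: c_def flip: reidx)
    qed (use assms in simp)
    then show "in_span n (map u qs) v" unfolding in_span_def by (intro exI[of _ c]) (auto simp: c_def)
  qed
qed

text \<open>\<open>kron_select\<close> accumulates only selected vectors, whereas this criterion
  involves all predecessors. The induction runs over the list with an arbitrary accumulator, and
  each rejected vector is absorbed by \<open>spanned_insert_redundant\<close>.\<close>

lemma kron_select_nth:
  assumes "distinct (qs @ ps)" "\<And>q. q \<in> set (qs @ ps) \<Longrightarrow> u q \<in> carrier_vec n" "k < length ps"
  shows "kron_select n (map u qs) (map u ps) ! k \<longleftrightarrow>
    \<not> spanned n (\<lambda>q x. vec_index (u q) x) (set qs \<union> set (take k ps)) (vec_index (u (ps ! k)))"
  using assms
proof (induction ps arbitrary: qs k)
  case (Cons p ps)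
  have head: "in_span n (map u qs) (u p) \<longleftrightarrow>
      spanned n (\<lambda>q x. vec_index (u q) x) (set qs) (vec_index (u p))"
    by (rule in_span_iff_spanned) (use Cons.prems in auto)
  show ?case
  proof (cases k)
    case 0
    then show ?thesis by (simp add: head)
  next
    case (Suc k')
    show ?thesis
    proof (cases "in_span n (map u qs) (u p)")
      case True
      let ?Q = "set qs \<union> set (take k' ps)"
      have "spanned n (\<lambda>q x. vec_index (u q) x) ?Q (vec_index (u p))"
        using True head by (auto intro: spanned_mono)
      from spanned_insert_redundant[OF _ this]
      have eq: "spanned n (\<lambda>q x. vec_index (u q) x) (insert p ?Q) v
          \<longleftrightarrow> spanned n (\<lambda>q x. vec_index (u q) x) ?Q v" for v by simp
      have "kron_select n (map u qs) (map u ps) ! k' \<longleftrightarrow>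
        \<not> spanned n (\<lambda>q x. vec_index (u q) x) ?Q (vec_index (u (ps ! k')))"
        by (rule Cons.IH) (use Cons.prems Suc in auto)
      then show ?thesis using True eq by (simp add: Suc)
    next
      case False
      have "kron_select n (map u (qs @ [p])) (map u ps) ! k' \<longleftrightarrow>
        \<not> spanned n (\<lambda>q x. vec_index (u q) x) (set (qs @ [p]) \<union> set (take k' ps)) (vec_index (u (ps ! k')))"
        by (rule Cons.IH) (use Cons.prems Suc in auto)
      then show ?thesis using False by (simp add: Suc)
    qed
  qed
qed simp

text \<open>Selection is phrased through all predecessors rather than recursively through the
  selected ones, so that it can be transported along shifts of the list.\<close>

definition greedy_basis :: "nat \<Rightarrow> (nat \<Rightarrow> nat \<Rightarrow> complex) \<Rightarrow> nat \<Rightarrow> nat set" where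
  "greedy_basis n w N = {p. p < N \<and> \<not> spanned n w {..<p} (w p)}"

lemma spanned_greedy_basis:
  assumes "p \<le> N" "spanned n w {..<p} v"
  shows "spanned n w (greedy_basis n w N \<inter> {..<p}) v"
  using assms
proof (induction p arbitrary: v)
  case (Suc p)
  let ?G = "greedy_basis n w N"
  have ins: "{..<Suc p} = insert p {..<p}" by auto
  show ?case
  proof (cases "p \<in> ?G")
    case True
    obtain c where c: "\<forall>x<n. v x = (\<Sum>q<Suc p. c q * w q x)"
      using Suc.prems(2) unfolding spanned_def by blast
    \<comment> \<open>Position \<open>p\<close> is selected: removing its term leaves a combination
      of vectors before \<open>p\<close>, to which the induction hypothesis applies.\<close>
    have "spanned n w {..<p} (\<lambda>x. v x - c p * w p x)"
      unfolding spanned_def using c by (intro exI[of _ c]) simp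
    with Suc obtain d where d: "\<forall>x<n. v x - c p * w p x = (\<Sum>q\<in>?G \<inter> {..<p}. d q * w q x)"
      unfolding spanned_def by force
    have G: "?G \<inter> {..<Suc p} = insert p (?G \<inter> {..<p})" using True by auto
    have "v x = (\<Sum>q\<in>?G \<inter> {..<Suc p}. (d(p := c p)) q * w q x)" if "x < n" for x
    proof -
      have "(\<Sum>q\<in>?G \<inter> {..<p}. (d(p := c p)) q * w q x) = v x - c p * w p x"
        using d that by (auto intro!: sum.cong)
      then show ?thesis by (simp add: G)
    qed
    then show ?thesis unfolding spanned_def by blast
  next
    case False
    then have "spanned n w {..<p} (w p)" using Suc.prems(1) by (auto simp: greedy_basis_def)
    with Suc.prems(2) have "spanned n w {..<p} v"
      unfolding ins by (subst (asm) spanned_insert_redundant) auto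
    moreover have "?G \<inter> {..<Suc p} = ?G \<inter> {..<p}" using False by (auto simp: less_Suc_eq)
    ultimately show ?thesis using Suc by simp
  qed
qed auto

text \<open>A nontrivial relation could be solved for its term of largest position, making that
  vector a combination of earlier ones.\<close>

lemma greedy_basis_independent:
  assumes "\<And>x. x < n \<Longrightarrow> (\<Sum>q\<in>greedy_basis n w N. c q * w q x) = 0" "p \<in> greedy_basis n w N"
  shows "c p = 0"
proof (rule ccontr)
  let ?G = "greedy_basis n w N"
  have fin: "finite ?G" by (simp add: greedy_basis_def)
  assume "c p \<noteq> 0"
  define M where "M = Max {q \<in> ?G. c q \<noteq> 0}"
  have M: "M \<in> ?G" "c M \<noteq> 0"
    using Max_in[of "{q \<in> ?G. c q \<noteq> 0}"] fin assms(2) \<open>c p \<noteq> 0\<close> unfolding M_def by auto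
  have le: "q \<le> M" if "q \<in> ?G" "c q \<noteq> 0" for q
    using that fin unfolding M_def by (intro Max_ge) auto
  have "w M x = (\<Sum>q\<in>?G \<inter> {..<M}. (- c q / c M) * w q x)" if "x < n" for x
  proof -
    have "0 = c M * w M x + (\<Sum>q\<in>?G - {M}. c q * w q x)"
      using assms(1)[OF that] sum.remove[OF fin M(1), of "\<lambda>q. c q * w q x"] by simp
    also have "(\<Sum>q\<in>?G - {M}. c q * w q x) = (\<Sum>q\<in>?G \<inter> {..<M}. c q * w q x)"
      using fin le by (intro sum.mono_neutral_right) (auto simp: order_le_less)
    finally have "c M * w M x = - (\<Sum>q\<in>?G \<inter> {..<M}. c q * w q x)" by (simp add: add_eq_0_iff)
    then have "w M x = - (\<Sum>q\<in>?G \<inter> {..<M}. c q * w q x) / c M"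
      using M(2) by (simp add: field_simps)
    then show ?thesis by (simp add: sum_divide_distrib sum_negf)
  qed
  then have "spanned n w (?G \<inter> {..<M}) (w M)"
    unfolding spanned_def by (intro exI[of _ "\<lambda>q. - c q / c M"]) blast
  then have "spanned n w {..<M} (w M)" by (rule spanned_mono) auto
  with M(1) show False by (simp add: greedy_basis_def)
qed

text \<open>A kernel vector is tested against the row of its nonzero entry with largest
  \<open>f\<close>: only the diagonal term survives there. This avoids permuting rows and columns
  into the order induced by \<open>f\<close>.\<close>

lemma det_nonzero_if_triangular_up_to_order:
  fixes M :: "complex mat" and f :: "nat \<Rightarrow> nat"
  assumes M: "M \<in> carrier_mat n n" and inj: "inj_on f {..<n}"
    and diag: "\<And>b. b < n \<Longrightarrow> M $$ (b, b) \<noteq> 0"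
    and below: "\<And>b b'. b < n \<Longrightarrow> b' < n \<Longrightarrow> f b' < f b \<Longrightarrow> M $$ (b, b') = 0"
  shows "Determinant.det M \<noteq> 0"
proof
  assume "Determinant.det M = 0"
  then obtain v where v: "v \<in> carrier_vec n" "v \<noteq> 0\<^sub>v n" "M *\<^sub>v v = 0\<^sub>v n"
    using det_0_iff_vec_prod_zero[OF M] by blast
  let ?S = "{b. b < n \<and> vec_index v b \<noteq> 0}"
  have ne: "?S \<noteq> {}" using v(1,2) by (auto simp: vec_eq_iff)
  then have "Max (f ` ?S) \<in> f ` ?S" by (intro Max_in) auto
  then obtain b where b: "b \<in> ?S" "f b = Max (f ` ?S)" by force
  have le: "f b' \<le> f b" if "b' \<in> ?S" for b' using that b(2) by simp
  have "0 = vec_index (M *\<^sub>v v) b" using v(3) b(1) by simp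
  also have "\<dots> = (\<Sum>b'<n. M $$ (b, b') * vec_index v b')"
    using M v(1) b(1) by (auto simp: scalar_prod_def lessThan_atLeast0 intro!: sum.cong)
  also have "\<dots> = (\<Sum>b'\<in>{b}. M $$ (b, b') * vec_index v b')"
  proof (rule sum.mono_neutral_right)
    show "\<forall>b'\<in>{..<n} - {b}. M $$ (b, b') * vec_index v b' = 0"
    proof
      fix b' assume b': "b' \<in> {..<n} - {b}"
      show "M $$ (b, b') * vec_index v b' = 0"
      proof (cases "vec_index v b' = 0")
        case False
        then have "f b' \<le> f b" using le b' by simp
        moreover have "f b' \<noteq> f b" using inj b' b(1) by (auto dest: inj_onD)
        ultimately show ?thesis using below[of b b'] b' b(1) by simp
      qed simp
    qed
  qed (use b in auto)
  finally show False using diag b(1) by simp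
qed

section \<open>Krylov vectors and Kronecker indices\<close>

text \<open>Quotient and remainder of \<open>p\<close> follow the flat order of
  \<open>krylov_list\<close>. Positions are not bounded by the length of that list, so shifts by
  whole rounds are always meaningful.\<close>

definition krylov :: "complex mat \<Rightarrow> complex mat \<Rightarrow> nat \<Rightarrow> nat \<Rightarrow> complex" where
  "krylov A B p x = (A ^\<^sub>m (p div dim_col B) * B) $$ (x, p mod dim_col B)"

lemma mult_mat_entry_sum:
  assumes "X \<in> carrier_mat r n" "Y \<in> carrier_mat n c" "i < r" "j < c"
  shows "(X * Y) $$ (i, j) = (\<Sum>y<n. X $$ (i, y) * Y $$ (y, j))"
  using assms by (auto simp: scalar_prod_def lessThan_atLeast0 intro!: sum.cong)

lemma pow_mat_add:
  assumes "A \<in> carrier_mat n n"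
  shows "A ^\<^sub>m (j + k) = A ^\<^sub>m j * A ^\<^sub>m k"
proof (induction k)
  case (Suc k)
  then show ?case using assms by (simp add: assoc_mult_mat[of _ n n _ n _ n])
qed (use assms in \<open>simp add: right_mult_one_mat[of _ n n]\<close>)

lemma krylov_shift:
  assumes A: "A \<in> carrier_mat n n" and B: "B \<in> carrier_mat n m" and "0 < m" "x < n"
  shows "krylov A B (p + k * m) x = (\<Sum>y<n. (A ^\<^sub>m k) $$ (x, y) * krylov A B p y)"
proof -
  have "krylov A B (p + k * m) x = (A ^\<^sub>m (k + p div m) * B) $$ (x, p mod m)"
    using assms by (simp add: krylov_def add.commute)
  also have "A ^\<^sub>m (k + p div m) * B = A ^\<^sub>m k * (A ^\<^sub>m (p div m) * B)"
    using A B by (simp add: pow_mat_add[OF A] assoc_mult_mat[of _ n n _ n _ m])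
  also have "\<dots> $$ (x, p mod m) = (\<Sum>y<n. (A ^\<^sub>m k) $$ (x, y) * krylov A B p y)"
    using assms by (subst mult_mat_entry_sum[of _ n n _ m])
      (auto simp: krylov_def simp del: index_mult_mat(1) intro: mult_carrier_mat)
  finally show ?thesis .
qed

text \<open>Multiplying a dependence relation by the \<open>k\<close>-th power of \<open>A\<close>
  moves every position up by \<open>k * m\<close>, and predecessors remain predecessors.
  Contrapositively, a selected \<open>A^j b_i\<close> forces all lower powers on \<open>b_i\<close>
  to be selected.\<close>

lemma spanned_krylov_shift:
  assumes A: "A \<in> carrier_mat n n" and B: "B \<in> carrier_mat n m" and "0 < m"
    and "spanned n (krylov A B) {..<p} (krylov A B p)"
  shows "spanned n (krylov A B) {..<p + k * m} (krylov A B (p + k * m))"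
proof -
  obtain c where c: "\<forall>x<n. krylov A B p x = (\<Sum>q<p. c q * krylov A B q x)"
    using assms(4) unfolding spanned_def by blast
  \<comment> \<open>The truncated subtraction is evaluated only on shifted positions, where it
    undoes the shift.\<close>
  let ?c = "\<lambda>q. c (q - k * m)"
  have "krylov A B (p + k * m) x = (\<Sum>q\<in>(\<lambda>q. q + k * m) ` {..<p}. ?c q * krylov A B q x)"
    if x: "x < n" for x
  proof -
    have "krylov A B (p + k * m) x = (\<Sum>y<n. \<Sum>q<p. c q * ((A ^\<^sub>m k) $$ (x, y) * krylov A B q y))"
      unfolding krylov_shift[OF A B \<open>0 < m\<close> x]
      using c by (intro sum.cong) (auto simp: sum_distrib_left mult_ac)
    also have "\<dots> = (\<Sum>q<p. c q * krylov A B (q + k * m) x)"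
      unfolding krylov_shift[OF A B \<open>0 < m\<close> x] by (subst sum.swap) (simp add: sum_distrib_left)
    finally show ?thesis by (simp add: sum.reindex)
  qed
  then have "spanned n (krylov A B) ((\<lambda>q. q + k * m) ` {..<p}) (krylov A B (p + k * m))"
    unfolding spanned_def by (intro exI[of _ ?c]) blast
  then show ?thesis by (rule spanned_mono) auto
qed

lemma concat_map_upt_eq:
  "concat (map (\<lambda>j. map (\<lambda>i. f j i) [0..<m]) [0..<n]) = map (\<lambda>p. f (p div m) (p mod m)) [0..<n * m]"
proof (induction n)
  case (Suc n)
  have "[0..<Suc n * m] = [0..<n * m] @ map (\<lambda>i. i + n * m) [0..<m]"
    unfolding map_add_upt using upt_add_eq_append[of 0 "n * m" m] by (simp add: add.commute)
  then show ?case using Suc by simp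
qed simp

lemma kron_select_krylov_list:
  assumes A: "A \<in> carrier_mat n n" and B: "B \<in> carrier_mat n m" and p: "p < n * m"
  shows "kron_select n [] (krylov_list A B) ! p \<longleftrightarrow> p \<in> greedy_basis n (krylov A B) (n * m)"
proof -
  have m: "0 < m" using p by (cases m) auto
  define u where "u q = (A ^\<^sub>m (q div m)) *\<^sub>v col B (q mod m)" for q
  have u: "u q \<in> carrier_vec n" for q using A unfolding u_def by (intro mult_mat_vec_carrier[of _ n n]) (use B in auto)
  have entry: "vec_index (u q) x = krylov A B q x" if "x < n" for q x
    using that A B m by (simp add: u_def krylov_def)
  have "krylov_list A B = map u [0..<n * m]"
    using A B unfolding krylov_list_def u_def by (simp add: concat_map_upt_eq)
  moreover have "kron_select n (map u []) (map u [0..<n * m]) ! p \<longleftrightarrow>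
    \<not> spanned n (\<lambda>q x. vec_index (u q) x) (set [] \<union> set (take p [0..<n * m])) (vec_index (u ([0..<n * m] ! p)))"
    by (rule kron_select_nth) (use u p in auto)
  ultimately have "kron_select n [] (krylov_list A B) ! p \<longleftrightarrow>
    \<not> spanned n (\<lambda>q x. vec_index (u q) x) {..<p} (vec_index (u p))"
    using p by (simp add: lessThan_atLeast0)
  also have "\<dots> \<longleftrightarrow> \<not> spanned n (krylov A B) {..<p} (krylov A B p)"
    unfolding spanned_def by (simp add: entry)
  finally show ?thesis using p by (simp add: greedy_basis_def)
qed

lemma down_closed_eq_lessThan_card:
  fixes D :: "nat set"
  assumes "finite D" "\<And>j k. k \<in> D \<Longrightarrow> j \<le> k \<Longrightarrow> j \<in> D"
  shows "D = {..<card D}"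
proof (cases "D = {}")
  case False
  have "D = {..Max D}"
  proof
    show "D \<subseteq> {..Max D}" using assms(1) by auto
    show "{..Max D} \<subseteq> D" using assms(2)[OF Max_in[OF assms(1) False]] by auto
  qed
  then show ?thesis by (metis card_atMost lessThan_Suc_atMost)
qed simp

lemma mult_add_less: "j * m + i < n * m" if "j < n" "i < m" for i j m n :: nat
proof -
  have "j * m + i < Suc j * m" using that by simp
  also have "\<dots> \<le> n * m" using that by (intro mult_le_mono1) simp
  finally show ?thesis .
qed

text \<open>For a fixed column the selected powers form an initial segment, so their number, the
  Kronecker index, determines them. The selected positions thus depend on \<open>\<kappa>\<close>
  alone. The guard \<open>0 < m\<close> empties the right side when there are no columns.\<close>

lemma greedy_basis_krylov:
  assumes A: "A \<in> carrier_mat n n" and B: "B \<in> carrier_mat n m"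
    and \<kappa>: "kronecker_indices A B = \<kappa>"
  shows "greedy_basis n (krylov A B) (n * m) = {p. 0 < m \<and> p div m < \<kappa> ! (p mod m)}"
proof -
  let ?G = "greedy_basis n (krylov A B) (n * m)"
  have G_iff: "j * m + i \<in> ?G \<longleftrightarrow> j < \<kappa> ! i" if i: "i < m" for i j
  proof -
    let ?D = "{j. j < n \<and> j * m + i \<in> ?G}"
    have "\<kappa> ! i = card {j. j < n \<and> kron_select n [] (krylov_list A B) ! (j * m + i)}"
      using i A B unfolding \<kappa>[symmetric] kronecker_indices_def by (simp add: Let_def)
    also have "{j. j < n \<and> kron_select n [] (krylov_list A B) ! (j * m + i)} = ?D"
      using kron_select_krylov_list[OF A B] mult_add_less i by blast
    finally have card: "\<kappa> ! i = card ?D" .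
    have D: "?D = {..<card ?D}"
    proof (rule down_closed_eq_lessThan_card)
      fix j k assume k: "k \<in> ?D" and "j \<le> k"
      show "j \<in> ?D"
      proof (rule ccontr)
        assume "j \<notin> ?D"
        then have "spanned n (krylov A B) {..<j * m + i} (krylov A B (j * m + i))"
          using k \<open>j \<le> k\<close> i mult_add_less[of j n i m] by (auto simp: greedy_basis_def)
        from spanned_krylov_shift[OF A B _ this, of "k - j"]
        have "spanned n (krylov A B) {..<k * m + i} (krylov A B (k * m + i))"
          using i \<open>j \<le> k\<close> by (simp add: diff_mult_distrib add.commute)
        with k show False by (simp add: greedy_basis_def)
      qed
    qed simp
    have "j < n" if "j * m + i \<in> ?G"
    proof -
      have "j * m + i < n * m" using that by (simp add: greedy_basis_def)
      then have "j * m < n * m" by linarith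
      then show "j < n" by simp
    qed
    then have "j * m + i \<in> ?G \<longleftrightarrow> j \<in> ?D" by blast
    also have "\<dots> \<longleftrightarrow> j < \<kappa> ! i" unfolding card by (subst D) simp
    finally show ?thesis .
  qed
  have "p \<in> ?G \<longleftrightarrow> 0 < m \<and> p div m < \<kappa> ! (p mod m)" for p
  proof (cases "m = 0")
    case False
    then show ?thesis using G_iff[of "p mod m" "p div m"] by simp
  qed (simp add: greedy_basis_def)
  then show "?G = {p. 0 < m \<and> p div m < \<kappa> ! (p mod m)}" by blast
qed

section \<open>The block structure of the Brunovsky pair\<close>

fun block_index :: "nat list \<Rightarrow> nat \<Rightarrow> nat \<times> nat" where
  "block_index [] a = (0, a)"
| "block_index (k # ks) a = (if a < k then (0, a) else (let (i, r) = block_index ks (a - k) in (Suc i, r)))"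

lemma block_index_cases:
  assumes "a < sum_list ks"
  obtains i r where "i < length ks" "r < ks ! i" "a = sum_list (take i ks) + r"
    "block_index ks a = (i, r)"
proof -
  have "\<exists>i r. i < length ks \<and> r < ks ! i \<and> a = sum_list (take i ks) + r \<and> block_index ks a = (i, r)"
    using assms
  proof (induction ks arbitrary: a)
    case (Cons k ks)
    show ?case
    proof (cases "a < k")
      case False
      then have "a - k < sum_list ks" using Cons.prems by simp
      then obtain i r where "i < length ks" "r < ks ! i" "a - k = sum_list (take i ks) + r"
          "block_index ks (a - k) = (i, r)"
        using Cons.IH by blast
      then show ?thesis using False by (intro exI[of _ "Suc i"] exI[of _ r]) auto
    qed auto
  qed simp
  then show ?thesis using that by blast
qed

lemma block_index_offset:
  assumes "i < length ks" "r < ks ! i"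
  shows "block_index ks (sum_list (take i ks) + r) = (i, r)"
    and "sum_list (take i ks) + r < sum_list ks"
proof -
  have "block_index ks (sum_list (take i ks) + r) = (i, r) \<and> sum_list (take i ks) + r < sum_list ks"
    using assms
  proof (induction ks arbitrary: i)
    case (Cons k ks)
    then show ?case by (cases i) (auto simp: add.assoc)
  qed simp
  then show "block_index ks (sum_list (take i ks) + r) = (i, r)"
    and "sum_list (take i ks) + r < sum_list ks" by auto
qed

lemma A_kappa_carrier: "A_kappa ks \<in> carrier_mat (sum_list ks) (sum_list ks)"
  by (induction ks) (auto simp: shift_mat_def)

lemma B_kappa_carrier: "B_kappa ks \<in> carrier_mat (sum_list ks) (length ks)"
  by (induction ks) (auto simp: first_unit_col_def)

lemma A_kappa_entry:
  assumes "a < sum_list ks" "b < sum_list ks"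
  shows "A_kappa ks $$ (a, b) = (if 0 < snd (block_index ks a) \<and> a = Suc b then 1 else 0)"
  using assms
proof (induction ks arbitrary: a b)
  case (Cons k ks)
  have D: "dim_row (A_kappa ks) = sum_list ks" "dim_col (A_kappa ks) = sum_list ks"
    using A_kappa_carrier[of ks] by auto
  \<comment> \<open>This handles the entry in row \<open>k\<close> and column \<open>k - 1\<close>,
    which lies on the global subdiagonal but crosses a block boundary: row \<open>k\<close> has
    offset 0, so the entry is 0.\<close>
  have "snd (block_index ks 0) = 0" if "0 < sum_list ks"
    using block_index_cases[OF that] by (metis add_is_0 snd_conv)
  then have z: "snd (block_index ks (a - k)) = 0" if "k = a" using that Cons.prems by simp
  show ?case using Cons.prems Cons.IH[of "a - k" "b - k"] z
    by (auto simp: D shift_mat_def split: prod.splits)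
qed simp

lemma B_kappa_entry:
  assumes "a < sum_list ks" "l < length ks"
  shows "B_kappa ks $$ (a, l) = (if block_index ks a = (l, 0) then 1 else 0)"
  using assms
proof (induction ks arbitrary: a l)
  case (Cons k ks)
  have D: "dim_row (B_kappa ks) = sum_list ks" "dim_col (B_kappa ks) = length ks"
    using B_kappa_carrier[of ks] by auto
  show ?case using Cons.prems Cons.IH[of "a - k" "l - 1"]
    by (cases l) (auto simp: D first_unit_col_def split: prod.splits)
qed simp

text \<open>The coordinate at offset \<open>r\<close> of block \<open>i\<close> stands for the
  vector \<open>A^r b_i\<close>; this is the place of that vector in the Krylov list.\<close>

definition krylov_position :: "nat list \<Rightarrow> nat \<Rightarrow> nat" where
  "krylov_position \<kappa> a = (case block_index \<kappa> a of (i, r) \<Rightarrow> r * length \<kappa> + i)"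

text \<open>Both definitions below depend on truncated subtraction and are only meaningful for
  blocks with \<open>\<kappa> ! i > 0\<close>.\<close>

definition dist_to_block_end :: "nat list \<Rightarrow> nat \<Rightarrow> nat" where
  "dist_to_block_end \<kappa> a = (case block_index \<kappa> a of (i, r) \<Rightarrow> \<kappa> ! i - 1 - r)"

definition block_end :: "nat list \<Rightarrow> nat \<Rightarrow> nat" where
  "block_end \<kappa> i = sum_list (take i \<kappa>) + (\<kappa> ! i - 1)"

lemma block_end:
  assumes "i < length \<kappa>" "0 < \<kappa> ! i"
  shows "block_end \<kappa> i < sum_list \<kappa>" "krylov_position \<kappa> (block_end \<kappa> i) = (\<kappa> ! i - 1) * length \<kappa> + i"
  using block_index_offset[of i \<kappa> "\<kappa> ! i - 1"] assms
  by (auto simp: block_end_def krylov_position_def)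

text \<open>Reaching the end of a block takes \<open>dist_to_block_end\<close> further
  multiplications by \<open>A\<close>, each worth one coordinate and \<open>length \<kappa>\<close>
  Krylov positions.\<close>

lemma add_dist_to_block_end:
  assumes "a < sum_list \<kappa>"
  shows "a + dist_to_block_end \<kappa> a = block_end \<kappa> (fst (block_index \<kappa> a))"
    and "a + dist_to_block_end \<kappa> a < sum_list \<kappa>"
    and "krylov_position \<kappa> (a + dist_to_block_end \<kappa> a)
      = krylov_position \<kappa> a + dist_to_block_end \<kappa> a * length \<kappa>"
proof -
  obtain i r where ir: "i < length \<kappa>" "r < \<kappa> ! i" "a = sum_list (take i \<kappa>) + r"
    "block_index \<kappa> a = (i, r)" using block_index_cases[OF assms] by blast
  have d: "dist_to_block_end \<kappa> a = \<kappa> ! i - 1 - r" by (simp add: dist_to_block_end_def ir(4))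
  show e: "a + dist_to_block_end \<kappa> a = block_end \<kappa> (fst (block_index \<kappa> a))"
    using ir by (simp add: dist_to_block_end_def block_end_def)
  show "a + dist_to_block_end \<kappa> a < sum_list \<kappa>"
    unfolding e using block_end(1)[of i \<kappa>] ir by simp
  have len: "(\<kappa> ! i - 1) * length \<kappa> = r * length \<kappa> + (\<kappa> ! i - 1 - r) * length \<kappa>"
    using ir(2) by (simp flip: add_mult_distrib)
  have "krylov_position \<kappa> (block_end \<kappa> i) = (\<kappa> ! i - 1) * length \<kappa> + i"
    using block_end(2) ir(1,2) by simp
  moreover have "krylov_position \<kappa> a = r * length \<kappa> + i" by (simp add: krylov_position_def ir(4))
  ultimately show "krylov_position \<kappa> (a + dist_to_block_end \<kappa> a)
      = krylov_position \<kappa> a + dist_to_block_end \<kappa> a * length \<kappa>"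
    unfolding e unfolding d by (simp only: ir(4) fst_conv len add_ac)
qed

lemma inj_on_krylov_position: "inj_on (krylov_position \<kappa>) {..<sum_list \<kappa>}"
proof (rule inj_onI)
  fix a b assume ab: "a \<in> {..<sum_list \<kappa>}" "b \<in> {..<sum_list \<kappa>}"
    and eq: "krylov_position \<kappa> a = krylov_position \<kappa> b"
  obtain i r where ir: "i < length \<kappa>" "a = sum_list (take i \<kappa>) + r" "block_index \<kappa> a = (i, r)"
    using ab block_index_cases by (metis lessThan_iff)
  obtain j s where js: "j < length \<kappa>" "b = sum_list (take j \<kappa>) + s" "block_index \<kappa> b = (j, s)"
    using ab block_index_cases by (metis lessThan_iff)
  have eq': "r * length \<kappa> + i = s * length \<kappa> + j" using eq ir js by (simp add: krylov_position_def)
  have "(r * length \<kappa> + i) div length \<kappa> = r" "(s * length \<kappa> + j) div length \<kappa> = s"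
    using ir(1) js(1) div_mult_self3[of "length \<kappa>"] by (metis add.right_neutral div_less gr_implies_not0)+
  with eq' have "r = s" by simp
  with eq' show "a = b" using ir js by simp
qed

text \<open>The right side is the set found in \<open>greedy_basis_krylov\<close>, so the
  coordinates enumerate exactly the selected vectors.\<close>

lemma krylov_position_image:
  "krylov_position \<kappa> ` {..<sum_list \<kappa>}
    = {p. 0 < length \<kappa> \<and> p div length \<kappa> < \<kappa> ! (p mod length \<kappa>)}"
proof (intro equalityI subsetI)
  fix p assume "p \<in> krylov_position \<kappa> ` {..<sum_list \<kappa>}"
  then obtain a where a: "a < sum_list \<kappa>" "p = krylov_position \<kappa> a" by auto
  from a(1) obtain i r where "i < length \<kappa>" "r < \<kappa> ! i" "block_index \<kappa> a = (i, r)"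
    by (rule block_index_cases)
  moreover from this have "\<kappa> \<noteq> []" by auto
  ultimately show "p \<in> {p. 0 < length \<kappa> \<and> p div length \<kappa> < \<kappa> ! (p mod length \<kappa>)}"
    using a(2) by (simp add: krylov_position_def)
next
  fix p assume p: "p \<in> {p. 0 < length \<kappa> \<and> p div length \<kappa> < \<kappa> ! (p mod length \<kappa>)}"
  then have "p mod length \<kappa> < length \<kappa>" by auto
  from block_index_offset[OF this, of "p div length \<kappa>"] p
  show "p \<in> krylov_position \<kappa> ` {..<sum_list \<kappa>}"
    by (intro image_eqI[of _ _ "sum_list (take (p mod length \<kappa>) \<kappa>) + p div length \<kappa>"])
      (auto simp: krylov_position_def)
qed

section \<open>Transformation to Brunovsky form\<close>

definition krylov_basis :: "nat list \<Rightarrow> complex mat \<Rightarrow> complex mat \<Rightarrow> complex mat" where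
  "krylov_basis \<kappa> A B = mat (sum_list \<kappa>) (sum_list \<kappa>)
     (\<lambda>(x, a). krylov A B (krylov_position \<kappa> a) x)"

text \<open>The inverse is written as adjugate over determinant because this explicit formula makes
  its continuity in the parameter accessible.\<close>

definition dual_basis :: "nat list \<Rightarrow> complex mat \<Rightarrow> complex mat \<Rightarrow> complex mat" where
  "dual_basis \<kappa> A B = (1 / Determinant.det (krylov_basis \<kappa> A B)) \<cdot>\<^sub>m adj_mat (krylov_basis \<kappa> A B)"

text \<open>With \<open>t\<^sub>i\<close> the functional dual to \<open>A\<^bsup>\<kappa>\<^sub>i-1\<^esup>b\<^sub>i\<close>, the \<open>i\<close>-th block of \<open>T\<close> has the rows
  \<open>t\<^sub>i A\<^bsup>\<kappa>\<^sub>i-1\<^esup>, \<dots>, t\<^sub>i A, t\<^sub>i\<close>. Rows of \<open>F\<close> and \<open>S\<close> belonging to an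
  absent block do not enter the equations and are chosen only to keep \<open>S\<close> unitriangular.\<close>

definition brunovsky_T :: "nat list \<Rightarrow> complex mat \<Rightarrow> complex mat \<Rightarrow> complex mat" where
  "brunovsky_T \<kappa> A B = mat (sum_list \<kappa>) (sum_list \<kappa>) (\<lambda>(a, c).
     (dual_basis \<kappa> A B * A ^\<^sub>m dist_to_block_end \<kappa> a) $$ (a + dist_to_block_end \<kappa> a, c))"

definition brunovsky_F :: "nat list \<Rightarrow> complex mat \<Rightarrow> complex mat \<Rightarrow> complex mat" where
  "brunovsky_F \<kappa> A B = mat (length \<kappa>) (sum_list \<kappa>) (\<lambda>(i, c).
     if \<kappa> ! i = 0 then 0 else (dual_basis \<kappa> A B * A ^\<^sub>m (\<kappa> ! i)) $$ (block_end \<kappa> i, c))"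

definition brunovsky_S :: "nat list \<Rightarrow> complex mat \<Rightarrow> complex mat \<Rightarrow> complex mat" where
  "brunovsky_S \<kappa> A B = mat (length \<kappa>) (length \<kappa>) (\<lambda>(i, l).
     if \<kappa> ! i = 0 then of_bool (i = l)
     else (dual_basis \<kappa> A B * A ^\<^sub>m (\<kappa> ! i - 1) * B) $$ (block_end \<kappa> i, l))"

locale reachable_pair =
  fixes A B :: "complex mat" and n m :: nat and \<kappa> :: "nat list"
  assumes A: "A \<in> carrier_mat n n" and B: "B \<in> carrier_mat n m"
    and indices: "kronecker_indices A B = \<kappa>" and reachable: "sum_list \<kappa> = n"
begin

abbreviation "K \<equiv> krylov_basis \<kappa> A B"
abbreviation "L \<equiv> dual_basis \<kappa> A B"
abbreviation "T \<equiv> brunovsky_T \<kappa> A B"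
abbreviation "pos \<equiv> krylov_position \<kappa>"
abbreviation "\<delta> \<equiv> dist_to_block_end \<kappa>"
abbreviation "G \<equiv> greedy_basis n (krylov A B) (n * m)"

text \<open>The pairing of dual functional \<open>e\<close> with the Krylov vector at
  \<open>p\<close>. The entries of \<open>T * K\<close>, \<open>T * B\<close> and the nontrivial
  rows of \<open>S\<close> all reduce to it.\<close>

definition coord :: "nat \<Rightarrow> nat \<Rightarrow> complex" where
  "coord e p = (\<Sum>y<n. L $$ (e, y) * krylov A B p y)"

lemma length_indices: "length \<kappa> = m"
  using B unfolding indices[symmetric] kronecker_indices_def by (simp add: Let_def)

lemma G_eq: "G = pos ` {..<n}"
  using greedy_basis_krylov[OF A B indices] krylov_position_image[of \<kappa>] reachable
  by (simp add: length_indices)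

lemma inj_pos: "inj_on pos {..<n}"
  using inj_on_krylov_position[of \<kappa>] reachable by simp

lemma pos_in_G: "a < n \<Longrightarrow> pos a \<in> G"
  unfolding G_eq by simp

lemma K_carrier: "K \<in> carrier_mat n n"
  by (simp add: krylov_basis_def reachable)

lemma L_carrier: "L \<in> carrier_mat n n"
  unfolding dual_basis_def using adj_mat(1)[OF K_carrier] by simp

lemma T_carrier: "T \<in> carrier_mat n n"
  by (simp add: brunovsky_T_def reachable)

lemma pow_carrier: "A ^\<^sub>m k \<in> carrier_mat n n"
  using A by simp

lemma det_K: "Determinant.det K \<noteq> 0"
proof
  assume "Determinant.det K = 0"
  then obtain v where v: "v \<in> carrier_vec n" "v \<noteq> 0\<^sub>v n" "K *\<^sub>v v = 0\<^sub>v n"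
    using det_0_iff_vec_prod_zero[OF K_carrier] by blast
  \<comment> \<open>A kernel vector of \<open>K\<close> is relabelled by Krylov positions, which
    turns it into a relation among the selected vectors.\<close>
  define c where "c q = vec_index v (inv_into {..<n} pos q)" for q
  have c: "c (pos a) = vec_index v a" if "a < n" for a
    unfolding c_def using inv_into_f_f[OF inj_pos] that by simp
  have "(\<Sum>q\<in>G. c q * krylov A B q x) = 0" if x: "x < n" for x
  proof -
    have "(\<Sum>q\<in>G. c q * krylov A B q x) = (\<Sum>a<n. K $$ (x, a) * vec_index v a)"
      unfolding G_eq using x
      by (simp add: sum.reindex[OF inj_pos] c krylov_basis_def reachable mult.commute)
    also have "\<dots> = vec_index (K *\<^sub>v v) x"
      using K_carrier v(1) x by (auto simp: scalar_prod_def lessThan_atLeast0 intro!: sum.cong)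
    finally show ?thesis using v(3) x by simp
  qed
  from greedy_basis_independent[OF this] have "vec_index v a = 0" if "a < n" for a
    using pos_in_G[OF that] c[OF that] by force
  then have "v = 0\<^sub>v n" using v(1) by auto
  with v(2) show False by simp
qed

lemma L_mult_K: "L * K = 1\<^sub>m n"
proof -
  have "L * K = (1 / Determinant.det K) \<cdot>\<^sub>m (adj_mat K * K)"
    unfolding dual_basis_def by (rule mult_smult_assoc_mat[OF adj_mat(1)[OF K_carrier] K_carrier])
  also have "\<dots> = 1\<^sub>m n" unfolding adj_mat(3)[OF K_carrier] using det_K by auto
  finally show ?thesis .
qed

lemma coord_pos:
  assumes "e < n" "a < n"
  shows "coord e (pos a) = (if e = a then 1 else 0)"
proof -
  have "coord e (pos a) = (L * K) $$ (e, a)"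
    using assms by (subst mult_mat_entry_sum[OF L_carrier K_carrier])
      (auto simp: coord_def krylov_basis_def reachable)
  then show ?thesis using assms by (simp add: L_mult_K)
qed

text \<open>The vector at \<open>p\<close> is a combination of selected vectors at positions up to
  \<open>p\<close>. All of these differ from \<open>pos e\<close>, so the functional dual to
  \<open>pos e\<close> kills each of them.\<close>

lemma coord_zero:
  assumes "e < n" "p < pos e"
  shows "coord e p = 0"
  unfolding coord_def
proof (rule functional_zero_if_spanned)
  have "spanned n (krylov A B) {p} (krylov A B p)"
    unfolding spanned_def by (intro exI[of _ "\<lambda>_. 1"]) simp
  \<comment> \<open>Including \<open>p\<close> itself avoids distinguishing whether \<open>p\<close>
    is selected.\<close>
  then have "spanned n (krylov A B) {..<Suc p} (krylov A B p)" by (rule spanned_mono) auto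
  moreover have "Suc p \<le> n * m" using pos_in_G[OF assms(1)] assms(2) by (simp add: greedy_basis_def)
  ultimately show "spanned n (krylov A B) (G \<inter> {..<Suc p}) (krylov A B p)"
    by (intro spanned_greedy_basis)
next
  fix q assume q: "q \<in> G \<inter> {..<Suc p}"
  then obtain a where a: "a < n" "q = pos a" unfolding G_eq by auto
  have "a \<noteq> e" using q a assms(2) by auto
  then show "(\<Sum>y<n. L $$ (e, y) * krylov A B q y) = 0"
    using coord_pos[OF assms(1) a(1)] a(2) by (simp add: coord_def)
qed

lemma dual_pow_input:
  assumes "e < n" "l < m"
  shows "(L * A ^\<^sub>m k * B) $$ (e, l) = coord e (k * m + l)"
proof -
  have "L * A ^\<^sub>m k * B = L * (A ^\<^sub>m k * B)"
    by (rule assoc_mult_mat[OF L_carrier pow_carrier B])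
  also have "\<dots> $$ (e, l) = coord e (k * m + l)"
    using assms B by (subst mult_mat_entry_sum[OF L_carrier mult_carrier_mat[OF pow_carrier B]])
      (auto simp: coord_def krylov_def simp del: index_mult_mat(1))
  finally show ?thesis .
qed

section \<open>Entries of \<open>T\<close> and \<open>S\<close>: invertibility and
  unitriangularity\<close>

lemma end_lt: "a < n \<Longrightarrow> a + \<delta> a < n"
  using add_dist_to_block_end(2)[of a \<kappa>] reachable by simp

lemma T_mult:
  assumes X: "X \<in> carrier_mat n c" and "a < n" "l < c"
  shows "(T * X) $$ (a, l) = (L * A ^\<^sub>m \<delta> a * X) $$ (a + \<delta> a, l)"
proof -
  have LA: "L * A ^\<^sub>m \<delta> a \<in> carrier_mat n n" by (rule mult_carrier_mat[OF L_carrier pow_carrier])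
  show ?thesis
    unfolding mult_mat_entry_sum[OF T_carrier X assms(2,3)]
      mult_mat_entry_sum[OF LA X end_lt[OF assms(2)] assms(3)]
    using assms(2) by (simp add: brunovsky_T_def reachable del: index_mult_mat(1))
qed

lemma pos_end: "a < n \<Longrightarrow> pos (a + \<delta> a) = pos a + \<delta> a * m"
  using add_dist_to_block_end(3)[of a \<kappa>] reachable length_indices by simp

text \<open>Row \<open>a\<close> of \<open>T\<close> is a dual functional composed with a power of
  \<open>A\<close>, and that power advances the selected vector \<open>b\<close> by
  \<open>\<delta> a\<close> rounds of the Krylov list.\<close>

lemma T_mult_K:
  assumes "a < n" "b < n"
  shows "(T * K) $$ (a, b) = coord (a + \<delta> a) (pos b + \<delta> a * m)"
proof -
  have m: "0 < m" using assms(1) reachable length_indices by (cases \<kappa>) auto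
  have AK: "A ^\<^sub>m \<delta> a * K \<in> carrier_mat n n" by (rule mult_carrier_mat[OF pow_carrier K_carrier])
  have "(A ^\<^sub>m \<delta> a * K) $$ (y, b) = krylov A B (pos b + \<delta> a * m) y" if y: "y < n" for y
    unfolding krylov_shift[OF A B m y] using y assms
    by (subst mult_mat_entry_sum[OF pow_carrier K_carrier]) (auto simp: krylov_basis_def reachable)
  moreover have "(T * K) $$ (a, b) = (L * (A ^\<^sub>m \<delta> a * K)) $$ (a + \<delta> a, b)"
    by (simp only: T_mult[OF K_carrier assms] assoc_mult_mat[OF L_carrier pow_carrier K_carrier])
  ultimately show ?thesis
    using assms end_lt by (simp add: mult_mat_entry_sum[OF L_carrier AK] coord_def del: index_mult_mat(1))
qed

lemma invertible_T: "invertible_mat T"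
proof -
  have TK: "T * K \<in> carrier_mat n n" by (rule mult_carrier_mat[OF T_carrier K_carrier])
  \<comment> \<open>Row \<open>b\<close> of \<open>T\<close> sends the selected vector at position \<open>pos b\<close> to the last selected vector of
    its block before applying \<open>t\<^sub>i\<close>, and all earlier ones to earlier positions.\<close>
  have "Determinant.det (T * K) \<noteq> 0"
  proof (rule det_nonzero_if_triangular_up_to_order[OF TK inj_pos])
    show "(T * K) $$ (b, b) \<noteq> 0" if "b < n" for b
      using that end_lt by (simp add: T_mult_K flip: pos_end) (simp add: coord_pos)
    show "(T * K) $$ (b, b') = 0" if "b < n" "b' < n" "pos b' < pos b" for b b'
      using that end_lt pos_end by (simp add: T_mult_K coord_zero)
  qed
  then have det: "Determinant.det T \<noteq> 0" by (simp add: det_mult[OF T_carrier K_carrier])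
  let ?R = "(1 / Determinant.det T) \<cdot>\<^sub>m adj_mat T"
  have R: "adj_mat T \<in> carrier_mat n n" by (rule adj_mat(1)[OF T_carrier])
  have "T * ?R = 1\<^sub>m n"
    unfolding mult_smult_distrib[OF T_carrier R] adj_mat(2)[OF T_carrier] using det by auto
  moreover have "?R * T = 1\<^sub>m n"
    unfolding mult_smult_assoc_mat[OF R T_carrier] adj_mat(3)[OF T_carrier] using det by auto
  ultimately show ?thesis
    using T_carrier R unfolding invertible_mat_def inverts_mat_def
    by (intro conjI exI[of _ ?R]) auto
qed

lemma S_entry:
  assumes "i < m" "l < m" "0 < \<kappa> ! i"
  shows "brunovsky_S \<kappa> A B $$ (i, l) = coord (block_end \<kappa> i) ((\<kappa> ! i - 1) * m + l)"
  using assms dual_pow_input block_end(1)[of i \<kappa>]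
  by (simp add: brunovsky_S_def length_indices reachable del: index_mult_mat(1))

text \<open>Row \<open>i\<close> pairs \<open>t_i\<close> with the vectors
  \<open>A^(\<kappa>_i - 1) b_l\<close>. For \<open>l = i\<close> this is the vector dual to
  \<open>t_i\<close>; for \<open>l < i\<close> it precedes that vector in the Krylov list.\<close>

lemma unitriangular_S:
  assumes "i < m" "l \<le> i"
  shows "brunovsky_S \<kappa> A B $$ (i, l) = of_bool (l = i)"
proof (cases "\<kappa> ! i = 0")
  case True
  then show ?thesis using assms by (simp add: brunovsky_S_def length_indices)
next
  case False
  have e: "block_end \<kappa> i < n" "pos (block_end \<kappa> i) = (\<kappa> ! i - 1) * m + i"
    using block_end[of i \<kappa>] False assms length_indices reachable by auto
  have S: "brunovsky_S \<kappa> A B $$ (i, l) = coord (block_end \<kappa> i) ((\<kappa> ! i - 1) * m + l)"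
    using S_entry[of i l] assms False by simp
  show ?thesis
  proof (cases "l = i")
    case True
    then show ?thesis using S coord_pos[OF e(1) e(1)] by (simp add: e(2))
  next
    case False
    then show ?thesis using S coord_zero[OF e(1)] assms by (simp add: e(2))
  qed
qed

section \<open>The two equations of the Brunovsky form\<close>

lemma A_kappa_mult:
  assumes X: "X \<in> carrier_mat n c" and "a < n" "l < c"
  shows "(A_kappa \<kappa> * X) $$ (a, l) = (if 0 < snd (block_index \<kappa> a) then X $$ (a - 1, l) else 0)"
proof -
  obtain i r where ir: "r < \<kappa> ! i" "a = sum_list (take i \<kappa>) + r" "block_index \<kappa> a = (i, r)"
    using assms(2) block_index_cases reachable by metis
  have "A_kappa \<kappa> \<in> carrier_mat n n" using A_kappa_carrier[of \<kappa>] reachable by simp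
  then have "(A_kappa \<kappa> * X) $$ (a, l) = (\<Sum>b<n. A_kappa \<kappa> $$ (a, b) * X $$ (b, l))"
    using assms by (intro mult_mat_entry_sum)
  \<comment> \<open>The truncation of \<open>a - 1\<close> at \<open>a = 0\<close> is harmless,
    since then \<open>r = 0\<close> and the summand vanishes.\<close>
  also have "\<dots> = (\<Sum>b<n. if b = a - 1 then (if 0 < r then X $$ (b, l) else 0) else 0)"
    using assms ir by (intro sum.cong) (auto simp: A_kappa_entry reachable)
  also have "\<dots> = (if 0 < r then X $$ (a - 1, l) else 0)" using assms(2) by (simp add: sum.delta)
  finally show ?thesis using ir by simp
qed

lemma B_kappa_mult:
  assumes X: "X \<in> carrier_mat m c" and "a < n" "l < c"
  shows "(B_kappa \<kappa> * X) $$ (a, l) =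
    (if snd (block_index \<kappa> a) = 0 then X $$ (fst (block_index \<kappa> a), l) else 0)"
proof -
  obtain i r where ir: "i < length \<kappa>" "block_index \<kappa> a = (i, r)"
    using assms(2) block_index_cases reachable by metis
  have "B_kappa \<kappa> \<in> carrier_mat n m" using B_kappa_carrier[of \<kappa>] reachable length_indices by simp
  then have "(B_kappa \<kappa> * X) $$ (a, l) = (\<Sum>j<m. B_kappa \<kappa> $$ (a, j) * X $$ (j, l))"
    using assms by (intro mult_mat_entry_sum)
  also have "\<dots> = (\<Sum>j<m. if j = i then (if r = 0 then X $$ (j, l) else 0) else 0)"
    using assms ir by (intro sum.cong) (auto simp: B_kappa_entry reachable length_indices)
  finally show ?thesis using ir length_indices by (simp add: sum.delta)
qed

text \<open>Below the first row of a block, \<open>A_kappa\<close> copies the previous row of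
  \<open>T\<close>, which is the current one times \<open>A\<close>, so the difference cancels. In
  the first row \<open>A_kappa\<close> contributes nothing and \<open>t_i A^(\<kappa>_i)\<close>
  remains, which is row \<open>i\<close> of \<open>F\<close>.\<close>

lemma state_equation: "T * A - A_kappa \<kappa> * T = B_kappa \<kappa> * brunovsky_F \<kappa> A B"
proof (rule eq_matI)
  note Ak = A_kappa_carrier[of \<kappa>, unfolded reachable]
    and Bk = B_kappa_carrier[of \<kappa>, unfolded reachable length_indices]
  have F: "brunovsky_F \<kappa> A B \<in> carrier_mat m n"
    by (simp add: brunovsky_F_def reachable length_indices)
  fix a c
  assume "a < dim_row (B_kappa \<kappa> * brunovsky_F \<kappa> A B)" "c < dim_col (B_kappa \<kappa> * brunovsky_F \<kappa> A B)"
  then have ac: "a < n" "c < n" using Bk F by auto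
  obtain i r where ir: "i < length \<kappa>" "r < \<kappa> ! i" "a = sum_list (take i \<kappa>) + r" "block_index \<kappa> a = (i, r)"
    using ac(1) block_index_cases reachable by metis
  have "(T * A) $$ (a, c) = (L * A ^\<^sub>m \<delta> a * A) $$ (a + \<delta> a, c)"
    by (rule T_mult[OF A ac])
  also have "L * A ^\<^sub>m \<delta> a * A = L * A ^\<^sub>m Suc (\<delta> a)"
    using assoc_mult_mat[OF L_carrier pow_carrier A] by simp
  finally have TA: "(T * A) $$ (a, c) = (L * A ^\<^sub>m Suc (\<delta> a)) $$ (a + \<delta> a, c)" .
  have d: "\<delta> a = \<kappa> ! i - 1 - r" by (simp add: dist_to_block_end_def ir(4))
  have "(T * A) $$ (a, c) - (A_kappa \<kappa> * T) $$ (a, c) = (B_kappa \<kappa> * brunovsky_F \<kappa> A B) $$ (a, c)"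
  proof (cases "r = 0")
    case True
    have "a + \<delta> a = block_end \<kappa> i" using add_dist_to_block_end(1)[of a \<kappa>] ac ir reachable by simp
    moreover have "Suc (\<delta> a) = \<kappa> ! i" using True d ir by simp
    ultimately show ?thesis
      unfolding TA A_kappa_mult[OF T_carrier ac] B_kappa_mult[OF F ac] using True ir ac
      by (simp add: brunovsky_F_def length_indices reachable del: index_mult_mat(1) pow_mat.simps)
  next
    case False
    have "block_index \<kappa> (a - 1) = (i, r - 1)"
      using block_index_offset(1)[of i \<kappa> "r - 1"] ir False by simp
    then have d': "\<delta> (a - 1) = Suc (\<delta> a)"
      using d ir False by (simp add: dist_to_block_end_def)
    have "a - 1 + \<delta> (a - 1) = a + \<delta> a" using d' ir False by simp
    with d' have "T $$ (a - 1, c) = (L * A ^\<^sub>m Suc (\<delta> a)) $$ (a + \<delta> a, c)"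
      using ac by (simp add: brunovsky_T_def reachable del: index_mult_mat(1) pow_mat.simps)
    then show ?thesis
      unfolding TA A_kappa_mult[OF T_carrier ac] B_kappa_mult[OF F ac] using False ir by simp
  qed
  then show "(T * A - A_kappa \<kappa> * T) $$ (a, c) = (B_kappa \<kappa> * brunovsky_F \<kappa> A B) $$ (a, c)"
    using ac Ak T_carrier by (simp del: index_mult_mat(1))
qed (use A_kappa_carrier[of \<kappa>] B_kappa_carrier[of \<kappa>] T_carrier A reachable in
  \<open>auto simp: brunovsky_F_def\<close>)

text \<open>The first row of each block yields a row of \<open>S\<close>. At offset
  \<open>r > 0\<close> the functional \<open>t_i\<close> meets
  \<open>A^(\<kappa>_i - 1 - r) b_l\<close>, which belongs to an earlier round than its dual vector,
  so both sides vanish.\<close>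

lemma input_equation: "T * B = B_kappa \<kappa> * brunovsky_S \<kappa> A B"
proof (rule eq_matI)
  note Bk = B_kappa_carrier[of \<kappa>, unfolded reachable length_indices]
  have S: "brunovsky_S \<kappa> A B \<in> carrier_mat m m"
    by (simp add: brunovsky_S_def length_indices)
  fix a l
  assume "a < dim_row (B_kappa \<kappa> * brunovsky_S \<kappa> A B)" "l < dim_col (B_kappa \<kappa> * brunovsky_S \<kappa> A B)"
  then have al: "a < n" "l < m" using Bk S by auto
  obtain i r where ir: "i < length \<kappa>" "r < \<kappa> ! i" "a = sum_list (take i \<kappa>) + r" "block_index \<kappa> a = (i, r)"
    using al(1) block_index_cases reachable by metis
  have i: "i < m" using ir(1) length_indices by simp
  have e: "a + \<delta> a = block_end \<kappa> i" "block_end \<kappa> i < n" "pos (block_end \<kappa> i) = (\<kappa> ! i - 1) * m + i"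
    using add_dist_to_block_end(1)[of a \<kappa>] block_end[of i \<kappa>] al ir reachable length_indices by auto
  have d: "\<delta> a = \<kappa> ! i - 1 - r" by (simp add: dist_to_block_end_def ir(4))
  have TB: "(T * B) $$ (a, l) = coord (block_end \<kappa> i) (\<delta> a * m + l)"
    unfolding T_mult[OF B al] e(1) by (rule dual_pow_input[OF e(2) al(2)])
  show "(T * B) $$ (a, l) = (B_kappa \<kappa> * brunovsky_S \<kappa> A B) $$ (a, l)"
  proof (cases "r = 0")
    case True
    then show ?thesis unfolding TB B_kappa_mult[OF S al]
      using ir d S_entry[OF i al(2)] by simp
  next
    case False
    have "\<delta> a * m + l < (\<kappa> ! i - 1) * m" using d ir False al(2) by (intro mult_add_less) auto
    then show ?thesis unfolding TB B_kappa_mult[OF S al]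
      using ir False coord_zero[OF e(2)] e(3) by simp
  qed
qed (use B_kappa_carrier[of \<kappa>] T_carrier B reachable in \<open>auto simp: brunovsky_S_def length_indices\<close>)

end

section \<open>Continuous dependence on the parameter\<close>

lemma continuous_mat_on_mult:
  assumes "continuous_mat_on P r n X" "continuous_mat_on P n c Y"
  shows "continuous_mat_on P r c (\<lambda>\<theta>. X \<theta> * Y \<theta>)"
  unfolding continuous_mat_on_def
proof (intro conjI ballI allI impI)
  show "X \<theta> * Y \<theta> \<in> carrier_mat r c" if "\<theta> \<in> P" for \<theta>
    using assms that by (auto simp: continuous_mat_on_def intro: mult_carrier_mat)
  fix i j assume ij: "i < r" "j < c"
  have "continuous_on P (\<lambda>\<theta>. \<Sum>y<n. X \<theta> $$ (i, y) * Y \<theta> $$ (y, j))"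
    using assms ij by (intro continuous_intros) (auto simp: continuous_mat_on_def)
  then show "continuous_on P (\<lambda>\<theta>. (X \<theta> * Y \<theta>) $$ (i, j))"
    using assms ij by (subst continuous_on_cong[OF refl mult_mat_entry_sum])
      (auto simp: continuous_mat_on_def)
qed

lemma continuous_mat_on_pow:
  assumes "continuous_mat_on P n n X"
  shows "continuous_mat_on P n n (\<lambda>\<theta>. X \<theta> ^\<^sub>m k)"
proof (induction k)
  case 0
  \<comment> \<open>The zeroth power is the identity of the size of \<open>X \<theta>\<close>, which
    is known to be \<open>n\<close> only on \<open>P\<close>.\<close>
  have "continuous_on P (\<lambda>\<theta>. (X \<theta> ^\<^sub>m 0) $$ (i, j))" if "i < n" "j < n" for i j
  proof (rule continuous_on_eq[OF continuous_on_const[of P "of_bool (i = j)"]])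
    fix \<theta> assume "\<theta> \<in> P"
    then have "X \<theta> \<in> carrier_mat n n" using assms by (auto simp: continuous_mat_on_def)
    then show "of_bool (i = j) = (X \<theta> ^\<^sub>m 0) $$ (i, j)" using that by simp
  qed
  then show ?case using assms pow_carrier_mat by (auto simp: continuous_mat_on_def simp del: pow_mat.simps)
next
  case (Suc k)
  then show ?case using continuous_mat_on_mult[OF Suc assms] by simp
qed

lemma continuous_on_det:
  assumes "continuous_mat_on P n n X"
  shows "continuous_on P (\<lambda>\<theta>. Determinant.det (X \<theta>))"
proof -
  have "continuous_on P (\<lambda>\<theta>. \<Sum>p | p permutes {0..<n}. signof p * (\<Prod>i = 0..<n. X \<theta> $$ (i, p i)))"
    using assms by (intro continuous_intros) (auto simp: continuous_mat_on_def dest: permutes_in_image)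
  then show ?thesis
    using assms by (subst continuous_on_cong[OF refl det_def']) (auto simp: continuous_mat_on_def)
qed

text \<open>Entries of the adjugate are signed minors, hence polynomials in the entries of the
  matrix.\<close>

lemma continuous_mat_on_adj_mat:
  assumes "continuous_mat_on P n n X"
  shows "continuous_mat_on P n n (\<lambda>\<theta>. adj_mat (X \<theta>))"
proof -
  have X: "X \<theta> \<in> carrier_mat n n" if "\<theta> \<in> P" for \<theta> using assms that by (auto simp: continuous_mat_on_def)
  have "continuous_on P (\<lambda>\<theta>. adj_mat (X \<theta>) $$ (i, j))" if ij: "i < n" "j < n" for i j
  proof -
    have "continuous_mat_on P (n - 1) (n - 1) (\<lambda>\<theta>. mat_delete (X \<theta>) j i)"
      unfolding continuous_mat_on_def
    proof (intro conjI ballI allI impI)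
      show "mat_delete (X \<theta>) j i \<in> carrier_mat (n - 1) (n - 1)" if "\<theta> \<in> P" for \<theta>
        by (rule mat_delete_carrier[OF X[OF that]])
      fix i' j' assume ij': "i' < n - 1" "j' < n - 1"
      \<comment> \<open>Entry \<open>(i, j)\<close> of the adjugate is the cofactor at
        \<open>(j, i)\<close>, so row \<open>j\<close> and column \<open>i\<close> are the ones
        skipped.\<close>
      let ?i = "if i' < j then i' else Suc i'" and ?j = "if j' < i then j' else Suc j'"
      have "continuous_on P (\<lambda>\<theta>. X \<theta> $$ (?i, ?j))"
        using assms ij' by (simp add: continuous_mat_on_def)
      then show "continuous_on P (\<lambda>\<theta>. mat_delete (X \<theta>) j i $$ (i', j'))"
        by (rule continuous_on_eq) (use ij' in \<open>auto simp: mat_delete_def X[THEN carrier_matD(1)] X[THEN carrier_matD(2)]\<close>)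
    qed
    then have "continuous_on P (\<lambda>\<theta>. cofactor (X \<theta>) j i)"
      unfolding cofactor_def by (intro continuous_intros continuous_on_det)
    then show ?thesis
      by (rule continuous_on_eq) (use ij in \<open>auto simp: adj_mat_def X[THEN carrier_matD(1)] X[THEN carrier_matD(2)]\<close>)
  qed
  then show ?thesis using X by (simp add: continuous_mat_on_def adj_mat(1))
qed

text \<open>Constancy of the Kronecker indices enters here: the same Krylov positions supply the
  columns of \<open>K\<close> for every parameter, so \<open>K\<close> is continuous, and its
  determinant never vanishes.\<close>

lemma continuous_mat_on_dual_basis:
  assumes A: "continuous_mat_on P n n A" and B: "continuous_mat_on P n m B"
    and pair: "\<And>\<theta>. \<theta> \<in> P \<Longrightarrow> reachable_pair (A \<theta>) (B \<theta>) n m \<kappa>"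
  shows "continuous_mat_on P n n (\<lambda>\<theta>. dual_basis \<kappa> (A \<theta>) (B \<theta>))"
\<comment> \<open>The size of \<open>\<kappa>\<close> is read off the pair at some point of
  \<open>P\<close>, hence the case split.\<close>
proof (cases "P = {}")
  case False
  then have len: "length \<kappa> = m" and sum: "sum_list \<kappa> = n"
    using reachable_pair.length_indices reachable_pair.reachable pair by blast+
  have "continuous_on P (\<lambda>\<theta>. krylov (A \<theta>) (B \<theta>) (krylov_position \<kappa> a) x)" if "a < n" "x < n" for a x
  proof -
    let ?p = "krylov_position \<kappa> a"
    have "0 < m" using that sum len by (cases \<kappa>) auto
    moreover have "continuous_mat_on P n m (\<lambda>\<theta>. A \<theta> ^\<^sub>m (?p div m) * B \<theta>)"
      by (intro continuous_mat_on_mult[of P n n] continuous_mat_on_pow A B)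
    ultimately have "continuous_on P (\<lambda>\<theta>. (A \<theta> ^\<^sub>m (?p div m) * B \<theta>) $$ (x, ?p mod m))"
      using that unfolding continuous_mat_on_def by simp
    then show ?thesis
      by (rule continuous_on_eq) (use B in \<open>auto simp: krylov_def continuous_mat_on_def carrier_matD\<close>)
  qed
  then have K: "continuous_mat_on P n n (\<lambda>\<theta>. krylov_basis \<kappa> (A \<theta>) (B \<theta>))"
    by (simp add: continuous_mat_on_def krylov_basis_def sum)
  note adj = continuous_mat_on_adj_mat[OF K]
  have "continuous_on P (\<lambda>\<theta>. 1 / Determinant.det (krylov_basis \<kappa> (A \<theta>) (B \<theta>))
      * adj_mat (krylov_basis \<kappa> (A \<theta>) (B \<theta>)) $$ (i, j))" if "i < n" "j < n" for i j
    using adj that reachable_pair.det_K[OF pair]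
    by (intro continuous_intros continuous_on_det[OF K]) (auto simp: continuous_mat_on_def)
  moreover have "dual_basis \<kappa> (A \<theta>) (B \<theta>) $$ (i, j) =
      1 / Determinant.det (krylov_basis \<kappa> (A \<theta>) (B \<theta>))
      * adj_mat (krylov_basis \<kappa> (A \<theta>) (B \<theta>)) $$ (i, j)" if "\<theta> \<in> P" "i < n" "j < n" for \<theta> i j
    using adj that by (auto simp: dual_basis_def continuous_mat_on_def carrier_matD)
  ultimately show ?thesis
    using reachable_pair.L_carrier[OF pair] by (simp add: continuous_mat_on_def cong: continuous_on_cong)
qed (simp add: continuous_mat_on_def)

theorem mainTheorem1:
  fixes P :: "complex set" and n m :: nat
    and A B :: "complex \<Rightarrow> complex mat" and \<kappa> :: "nat list"
  assumes "jordan_arc P"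
    and "continuous_mat_on P n n A"
    and "continuous_mat_on P n m B"
    and "\<forall>\<theta>\<in>P. kronecker_indices (A \<theta>) (B \<theta>) = \<kappa>"
    and "sum_list \<kappa> = n"
  shows "\<exists>T F S. continuous_mat_on P n n T \<and> continuous_mat_on P m n F \<and>
           continuous_mat_on P m m S \<and>
           (\<forall>\<theta>\<in>P. invertible_mat (T \<theta>) \<and> upper_triangular (S \<theta>) \<and>
                    (\<forall>i<m. S \<theta> $$ (i, i) = 1) \<and>
                    T \<theta> * A \<theta> - A_kappa \<kappa> * T \<theta> = B_kappa \<kappa> * F \<theta> \<and>
                    T \<theta> * B \<theta> = B_kappa \<kappa> * S \<theta>)"
proof -
  have pair: "reachable_pair (A \<theta>) (B \<theta>) n m \<kappa>" if "\<theta> \<in> P" for \<theta>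
    using assms that by unfold_locales (auto simp: continuous_mat_on_def)
  have "P \<noteq> {}" using assms(1) by (auto simp: jordan_arc_def)
  then have len: "length \<kappa> = m" using reachable_pair.length_indices pair by blast
  note L = continuous_mat_on_dual_basis[OF assms(2,3) pair]
  have LA: "continuous_mat_on P n n (\<lambda>\<theta>. dual_basis \<kappa> (A \<theta>) (B \<theta>) * A \<theta> ^\<^sub>m k)" for k
    by (intro continuous_mat_on_mult[OF L] continuous_mat_on_pow assms)
  have LAB: "continuous_mat_on P n m (\<lambda>\<theta>. dual_basis \<kappa> (A \<theta>) (B \<theta>) * A \<theta> ^\<^sub>m k * B \<theta>)" for k
    by (intro continuous_mat_on_mult[OF LA] assms)
  \<comment> \<open>For an absent block \<open>block_end\<close> may fall outside the matrix, so the
    bound is restricted to nonzero indices; the other rows of \<open>F\<close> and \<open>S\<close>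
    are constant.\<close>
  have end_lt: "block_end \<kappa> i < n" if "i < m" "\<kappa> ! i \<noteq> 0" for i
    using block_end(1)[of i \<kappa>] that len assms(5) by simp
  have "continuous_mat_on P n n (\<lambda>\<theta>. brunovsky_T \<kappa> (A \<theta>) (B \<theta>))"
    using LA add_dist_to_block_end(2)[of _ \<kappa>]
    by (simp add: continuous_mat_on_def brunovsky_T_def assms(5) del: index_mult_mat(1))
  moreover have "continuous_mat_on P m n (\<lambda>\<theta>. brunovsky_F \<kappa> (A \<theta>) (B \<theta>))"
  proof -
    have "continuous_on P (\<lambda>\<theta>. brunovsky_F \<kappa> (A \<theta>) (B \<theta>) $$ (i, j))" if "i < m" "j < n" for i j
      using that LA end_lt[OF that(1)]
      by (cases "\<kappa> ! i = 0")
        (simp_all add: continuous_mat_on_def brunovsky_F_def assms(5) len del: index_mult_mat(1))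
    then show ?thesis by (simp add: continuous_mat_on_def) (simp add: brunovsky_F_def assms(5) len)
  qed
  moreover have "continuous_mat_on P m m (\<lambda>\<theta>. brunovsky_S \<kappa> (A \<theta>) (B \<theta>))"
  proof -
    have "continuous_on P (\<lambda>\<theta>. brunovsky_S \<kappa> (A \<theta>) (B \<theta>) $$ (i, j))" if "i < m" "j < m" for i j
      using that LAB end_lt[OF that(1)]
      by (cases "\<kappa> ! i = 0")
        (simp_all add: continuous_mat_on_def brunovsky_S_def len del: index_mult_mat(1))
    then show ?thesis by (simp add: continuous_mat_on_def) (simp add: brunovsky_S_def len)
  qed
  moreover have "upper_triangular (brunovsky_S \<kappa> (A \<theta>) (B \<theta>))" if "\<theta> \<in> P" for \<theta>
    using reachable_pair.unitriangular_S[OF pair[OF that]]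
    by (intro upper_triangularI) (simp add: brunovsky_S_def len)
  ultimately show ?thesis
    using reachable_pair.invertible_T[OF pair] reachable_pair.state_equation[OF pair]
      reachable_pair.input_equation[OF pair] reachable_pair.unitriangular_S[OF pair]
    by - (rule exI[of _ "\<lambda>\<theta>. brunovsky_T \<kappa> (A \<theta>) (B \<theta>)"],
      rule exI[of _ "\<lambda>\<theta>. brunovsky_F \<kappa> (A \<theta>) (B \<theta>)"],
      rule exI[of _ "\<lambda>\<theta>. brunovsky_S \<kappa> (A \<theta>) (B \<theta>)"], auto)
qed

end
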